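(* Let $\mathcal A$ be a unital complex $C^*$-algebra and let $\mathscr E$ be a Hilbert $C^*$-module over $\mathcal A$ with $\mathcal A$-valued inner product $\langle\cdot|\cdot\rangle$ and norm $\|e\|=\|\langle e|e\rangle\|^{1/2}$. Let $e\in\mathscr E$, let $\mathscr F$ be a (complex linear) subspace of $\mathscr E$, and let $f_0\in\mathscr F$ be a best approximation to $e$ in $\mathscr F$, i.e. $\|e-f_0\|\le\|e-f\|$ for all $f\in\mathscr F$. For a state $\phi$ on $\mathcal A$, let $\mathcal L_\phi=\{x\in\mathscr E:\phi(\langle x|x\rangle)=0\}$, equip $\mathscr E/\mathcal L_\phi$ with the inner product $\langle e_1+\mathcal L_\phi\,|\,e_2+\mathcal L_\phi\rangle=\phi(\langle e_1|e_2\rangle)$, let $\mathscr F/\mathcal L_\phi=\{f+\mathcal L_\phi:f\in\mathscr F\}$, and define $$M_{e,\mathscr F}(\phi)=\sup\Big\{\phi\big(\langle e-f_0|e-f_0\rangle\big)-\sum_\alpha\big|\phi\big(\langle e-f_0|f_\alpha\rangle\big)\big|^2\Big\},$$ where the supremum is taken over all orthonormal bases $\{f_\alpha+\mathcal L_\phi\}$ (with $f_\alpha\in\mathscr F$) of $\mathscr F/\mathcal L_\phi$ in the inner product space $\mathscr E/\mathcal L_\phi$. Then $$\operatorname{dist}(e,\mathscr F)^2=\max\{M_{e,\mathscr F}(\phi):\phi\in S_{\mathcal A}\},$$ where $\operatorname{dist}(e,\mathscr F)=\inf\{\|e-f\|:f\in\mathscr F\}$ and $S_{\mathcal A}$ is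 the set of states on $\mathcal A$.
   Context: A state on a unital complex $C^*$-algebra $\mathcal A$ with identity $1_{\mathcal A}$ is a linear functional $\phi$ on $\mathcal A$ with $\phi(1_{\mathcal A})=1$ and $\phi(c)\ge 0$ for every positive element $c\in\mathcal A$. $S_{\mathcal A}$ denotes the set of all states on $\mathcal A$. *)

theory Defs
  imports "HOL-Analysis.Analysis"
begin

class cvector = real_vector +
  fixes cscale :: "complex \<Rightarrow> 'a \<Rightarrow> 'a"
  assumes cscale_add_right: "cscale a (x + y) = cscale a x + cscale a y"
    and cscale_add_left: "cscale (a + b) x = cscale a x + cscale b x"
    and cscale_cscale: "cscale a (cscale b x) = cscale (a * b) x"
    and cscale_one: "cscale 1 x = x"
    and scaleR_cscale: "scaleR r x = cscale (complex_of_real r) x"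

class cnormed_vector = cvector + real_normed_vector +
  assumes norm_cscale: "norm (cscale a x) = cmod a * norm x"

class cstar_algebra = cnormed_vector + real_normed_algebra_1 + banach +
  fixes adj :: "'a \<Rightarrow> 'a"
  assumes mult_cscale_left: "cscale a x * y = cscale a (x * y)"
    and mult_cscale_right: "x * cscale a y = cscale a (x * y)"
    and adj_adj: "adj (adj x) = x"
    and adj_add: "adj (x + y) = adj x + adj y"
    and adj_cscale: "adj (cscale a x) = cscale (cnj a) (adj x)"
    and adj_mult: "adj (x * y) = adj y * adj x"
    and cstar_identity: "norm (adj x * x) = (norm x)\<^sup>2"

definition alg_invertible :: "'a::cstar_algebra \<Rightarrow> bool" where
  "alg_invertible x \<longleftrightarrow> (\<exists>y. x * y = 1 \<and> y * x = 1)"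

definition alg_spectrum :: "'a::cstar_algebra \<Rightarrow> complex set" where
  "alg_spectrum x = {z. \<not> alg_invertible (x - cscale z 1)}"

definition positive_elem :: "'a::cstar_algebra \<Rightarrow> bool" where
  "positive_elem c \<longleftrightarrow> adj c = c \<and> alg_spectrum c \<subseteq> {z. Im z = 0 \<and> 0 \<le> Re z}"

definition is_state :: "('a::cstar_algebra \<Rightarrow> complex) \<Rightarrow> bool" where
  "is_state \<phi> \<longleftrightarrow>
     (\<forall>x y. \<phi> (x + y) = \<phi> x + \<phi> y) \<and>
     (\<forall>a x. \<phi> (cscale a x) = a * \<phi> x) \<and>
     \<phi> 1 = 1 \<and>
     (\<forall>c. positive_elem c \<longrightarrow> Im (\<phi> c) = 0 \<and> 0 \<le> Re (\<phi> c))"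

definition hnorm :: "('m \<Rightarrow> 'm \<Rightarrow> 'a::cstar_algebra) \<Rightarrow> 'm \<Rightarrow> real" where
  "hnorm ip x = sqrt (norm (ip x x))"

definition hilbert_module ::
  "('m::cvector \<Rightarrow> 'a::cstar_algebra \<Rightarrow> 'm) \<Rightarrow> ('m \<Rightarrow> 'm \<Rightarrow> 'a) \<Rightarrow> bool" where
  "hilbert_module act ip \<longleftrightarrow>
     \<comment> \<open>right A-module structure compatible with the complex structure\<close>
     (\<forall>x y a. act (x + y) a = act x a + act y a) \<and>
     (\<forall>x a b. act x (a + b) = act x a + act x b) \<and>
     (\<forall>x a b. act x (a * b) = act (act x a) b) \<and>
     (\<forall>x. act x 1 = x) \<and>
     (\<forall>c x a. act (cscale c x) a = cscale c (act x a)) \<and>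
     (\<forall>c x a. act x (cscale c a) = cscale c (act x a)) \<and>
     \<comment> \<open>A-valued inner product\<close>
     (\<forall>x y z. ip x (y + z) = ip x y + ip x z) \<and>
     (\<forall>c x y. ip x (cscale c y) = cscale c (ip x y)) \<and>
     (\<forall>x y a. ip x (act y a) = ip x y * a) \<and>
     (\<forall>x y. ip y x = adj (ip x y)) \<and>
     (\<forall>x. positive_elem (ip x x)) \<and>
     (\<forall>x. ip x x = 0 \<longrightarrow> x = 0) \<and>
     \<comment> \<open>completeness for the norm sqrt of norm of ip x x\<close>
     (\<forall>X. (\<forall>\<epsilon>>0. \<exists>N. \<forall>m\<ge>N. \<forall>n\<ge>N. hnorm ip (X m - X n) < \<epsilon>) \<longrightarrow>
          (\<exists>L. (\<lambda>n. hnorm ip (X n - L)) \<longlonglongrightarrow> 0))"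

definition csubspace :: "'m::cvector set \<Rightarrow> bool" where
  "csubspace F \<longleftrightarrow> 0 \<in> F \<and> (\<forall>x\<in>F. \<forall>y\<in>F. x + y \<in> F) \<and> (\<forall>c. \<forall>x\<in>F. cscale c x \<in> F)"

text \<open>A set B of representatives f in F whose classes f + L_phi form an orthonormal basis
  (maximal orthonormal set) of F/L_phi, for the inner product
  (e1 + L_phi | e2 + L_phi) = phi (ip e1 e2).\<close>
definition onb_quot ::
  "('a::cstar_algebra \<Rightarrow> complex) \<Rightarrow> ('m \<Rightarrow> 'm \<Rightarrow> 'a) \<Rightarrow> 'm set \<Rightarrow> 'm set \<Rightarrow> bool" where
  "onb_quot \<phi> ip F B \<longleftrightarrow>
     B \<subseteq> F \<and>
     (\<forall>b\<in>B. \<forall>b'\<in>B. \<phi> (ip b b') = (if b = b' then 1 else 0)) \<and>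
     \<not> (\<exists>x\<in>F. \<phi> (ip x x) = 1 \<and> (\<forall>b\<in>B. \<phi> (ip b x) = 0))"

definition M_eF ::
  "('m::cvector \<Rightarrow> 'm \<Rightarrow> 'a::cstar_algebra) \<Rightarrow> 'm \<Rightarrow> 'm set \<Rightarrow> 'm \<Rightarrow> ('a \<Rightarrow> complex) \<Rightarrow> real" where
  "M_eF ip e F f0 \<phi> =
     Sup {Re (\<phi> (ip (e - f0) (e - f0))) - (\<Sum>\<^sub>\<infinity>b\<in>B. (cmod (\<phi> (ip (e - f0) b)))\<^sup>2) | B.
            onb_quot \<phi> ip F B}"

definition hdist_set :: "('m::cvector \<Rightarrow> 'm \<Rightarrow> 'a::cstar_algebra) \<Rightarrow> 'm \<Rightarrow> 'm set \<Rightarrow> real" where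
  "hdist_set ip e F = Inf {hnorm ip (e - f) | f. f \<in> F}"

end

theory Submission
  imports Defs
begin

text \<open>
  Put \<open>x = e - f0\<close> and \<open>N = norm \<langle>x|x\<rangle> = dist(e,F)\<^sup>2\<close>. Every value in the supremum defining \<open>M\<close> is
  at most \<open>\<phi>(\<langle>x|x\<rangle>) \<le> N\<close>, so it suffices to find a state \<open>\<phi>\<close> with \<open>\<phi>(\<langle>x|x\<rangle>) = N\<close> that annihilates
  all \<open>\<langle>x|f\<rangle>\<close> with \<open>f \<in> F\<close>. The functional \<open>p(a) = inf {norm (t + a) - t : t real}\<close> is sublinear, and
  real-linear functionals below \<open>p\<close> are exactly the real parts of states. Best approximation gives
  \<open>N \<le> p(\<langle>x|x\<rangle> + \<langle>x|f\<rangle>)\<close> for all \<open>f \<in> F\<close>, and the Hahn--Banach theorem in Mazur--Orlicz form turns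
  this into a linear \<open>g \<le> p\<close> with \<open>N \<le> g(\<langle>x|x\<rangle>) + g(\<langle>x|f\<rangle>)\<close> on the subspace \<open>F\<close>, which forces
  \<open>g(\<langle>x|x\<rangle>) = N\<close> and \<open>g(\<langle>x|f\<rangle>) = 0\<close>.
\<close>

section \<open>Sublinear functionals\<close>

definition sublinear :: "('v::real_vector \<Rightarrow> real) \<Rightarrow> bool" where
  "sublinear p \<longleftrightarrow> (\<forall>x y. p (x + y) \<le> p x + p y) \<and> (\<forall>r>0. \<forall>x. p (r *\<^sub>R x) \<le> r * p x) \<and> p 0 = 0"

lemma sublinear_add: "sublinear p \<Longrightarrow> p (x + y) \<le> p x + p y"
  by (simp add: sublinear_def)

lemma sublinear_zero: "sublinear p \<Longrightarrow> p 0 = 0"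
  by (simp add: sublinear_def)

lemma sublinear_scaleR:
  assumes "sublinear p" "r \<ge> 0"
  shows "p (r *\<^sub>R x) = r * p x"
proof (cases "r = 0")
  case True
  then show ?thesis using assms by (simp add: sublinear_def)
next
  case False
  then have r: "r > 0" using assms by simp
  have "p (inverse r *\<^sub>R (r *\<^sub>R x)) \<le> inverse r * p (r *\<^sub>R x)"
    using assms(1) r unfolding sublinear_def by (metis inverse_positive_iff_positive)
  then have "r * p x \<le> p (r *\<^sub>R x)"
    using r by (simp add: field_simps)
  moreover have "p (r *\<^sub>R x) \<le> r * p x"
    using assms(1) r by (simp add: sublinear_def)
  ultimately show ?thesis by simp
qed

lemma sublinear_minus_le: "sublinear p \<Longrightarrow> - p (- x) \<le> p x"
  using sublinear_add[of p x "- x"] sublinear_zero[of p] by simp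

text \<open>The infimum of \<open>p (x + s *\<^sub>R w) - s * N\<close> over
  \<open>s \<ge> 0\<close> and \<open>w \<in> K\<close> is the largest sublinear functional with
  both bounds; \<open>N \<le> p\<close> on \<open>K\<close> keeps it finite.\<close>

lemma sublinear_lower_on_convex:
  fixes p :: "'v::real_vector \<Rightarrow> real"
  assumes p: "sublinear p" and K: "convex K" "K \<noteq> {}" and N: "\<And>w. w \<in> K \<Longrightarrow> N \<le> p w"
  shows "\<exists>q. sublinear q \<and> (\<forall>x. q x \<le> p x) \<and> (\<forall>w\<in>K. q (- w) \<le> - N)"
proof -
  define I where "I = {0::real..} \<times> K"
  define h where "h x i = p (x + fst i *\<^sub>R snd i) - fst i * N" for x :: 'v and i :: "real \<times> 'v"
  define q where "q x = (INF i\<in>I. h x i)" for x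
  have I0: "I \<noteq> {}" using K by (auto simp: I_def)
  have low: "- p (- x) \<le> h x i" if iI: "i \<in> I" for x i
  proof -
    obtain s w where i: "i = (s, w)" "s \<ge> 0" "w \<in> K" using iI by (auto simp: I_def)
    have "p (s *\<^sub>R w) \<le> p (x + s *\<^sub>R w) + p (- x)"
      using sublinear_add[OF p, of "x + s *\<^sub>R w" "- x"] by simp
    moreover have "s * N \<le> p (s *\<^sub>R w)"
      using sublinear_scaleR[OF p i(2)] N[OF i(3)] i(2) by (simp add: mult_left_mono)
    ultimately show ?thesis by (simp add: h_def i)
  qed
  have bdd: "bdd_below (h x ` I)" for x
    using low by (auto intro!: bdd_belowI[of _ "- p (- x)"])
  have q_le: "q x \<le> h x i" if "i \<in> I" for x i
    unfolding q_def using bdd that by (rule cINF_lower)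
  have q_ge: "c \<le> q x" if "\<And>i. i \<in> I \<Longrightarrow> c \<le> h x i" for c x
    unfolding q_def using I0 that by (rule cINF_greatest)
  obtain w0 where w0: "w0 \<in> K" using K by blast
  have q_le_p: "q x \<le> p x" for x
    using q_le[of "(0, w0)" x] w0 by (simp add: I_def h_def)
  have "q (x + y) \<le> q x + q y" for x y
  proof -
    have 1: "q (x + y) \<le> h x i + h y j" if ij: "i \<in> I" "j \<in> I" for i j
    proof -
      obtain s w where i: "i = (s, w)" "s \<ge> 0" "w \<in> K" using ij by (auto simp: I_def)
      obtain t v where j: "j = (t, v)" "t \<ge> 0" "v \<in> K" using ij by (auto simp: I_def)
      \<comment> \<open>Convexity enters here: a sum of nonnegative multiples of two points of
        \<open>K\<close> is a nonnegative multiple of a single point of \<open>K\<close>.\<close>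
      obtain u where u: "u \<in> K" "s *\<^sub>R w + t *\<^sub>R v = (s + t) *\<^sub>R u"
      proof (cases "s + t = 0")
        case True
        then have "s = 0" "t = 0" using i j by linarith+
        then show ?thesis using that[of w0] w0 by simp
      next
        case False
        have "(s / (s + t)) *\<^sub>R w + (t / (s + t)) *\<^sub>R v \<in> K"
          using False i j K(1) by (intro convexD) (auto simp: add_divide_distrib[symmetric])
        moreover have "(s + t) *\<^sub>R ((s / (s + t)) *\<^sub>R w + (t / (s + t)) *\<^sub>R v) = s *\<^sub>R w + t *\<^sub>R v"
          using False by (simp add: scaleR_add_right)
        ultimately show ?thesis using that by metis
      qed
      have "q (x + y) \<le> p (x + y + (s + t) *\<^sub>R u) - (s + t) * N"
        using q_le[of "(s + t, u)"] u i j by (simp add: I_def h_def)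
      also have "x + y + (s + t) *\<^sub>R u = (x + s *\<^sub>R w) + (y + t *\<^sub>R v)"
        by (simp flip: u(2))
      also have "p \<dots> \<le> p (x + s *\<^sub>R w) + p (y + t *\<^sub>R v)"
        by (rule sublinear_add[OF p])
      finally show ?thesis by (simp add: h_def i j algebra_simps)
    qed
    have "q (x + y) - h y j \<le> q x" if "j \<in> I" for j
      using 1 that by (intro q_ge) (simp add: algebra_simps)
    then have "q (x + y) - q x \<le> q y"
      by (intro q_ge) (simp add: algebra_simps)
    then show ?thesis by simp
  qed
  moreover have "q (r *\<^sub>R x) \<le> r * q x" if r: "r > 0" for r x
  proof -
    have "q (r *\<^sub>R x) / r \<le> q x"
    proof (rule q_ge)
      fix i assume "i \<in> I"
      then obtain s w where i: "i = (s, w)" "s \<ge> 0" "w \<in> K" by (auto simp: I_def)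
      have "q (r *\<^sub>R x) \<le> p (r *\<^sub>R x + (r * s) *\<^sub>R w) - (r * s) * N"
        using q_le[of "(r * s, w)"] r i by (simp add: I_def h_def)
      also have "r *\<^sub>R x + (r * s) *\<^sub>R w = r *\<^sub>R (x + s *\<^sub>R w)"
        by (simp add: scaleR_add_right)
      also have "p \<dots> = r * p (x + s *\<^sub>R w)"
        using sublinear_scaleR[OF p] r by simp
      finally show "q (r *\<^sub>R x) / r \<le> h x i"
        using r by (simp add: h_def i field_simps)
    qed
    then show ?thesis using r by (simp add: field_simps)
  qed
  moreover have "q 0 = 0"
    using q_le_p[of 0] q_ge[of 0 0] low[of _ 0] sublinear_zero[OF p] by fastforce
  ultimately have "sublinear q" by (simp add: sublinear_def)
  moreover have "q (- w) \<le> - N" if "w \<in> K" for w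
    using q_le[of "(1, w)" "- w"] that sublinear_zero[OF p] by (simp add: I_def h_def)
  ultimately show ?thesis using q_le_p by blast
qed

text \<open>Zorn's lemma applies because the pointwise infimum of a nonempty chain stays sublinear;
  \<open>- p (- x)\<close> bounds all members of the chain from below at \<open>x\<close>.\<close>

lemma minimal_sublinear_exists:
  fixes p :: "'v::real_vector \<Rightarrow> real"
  assumes p: "sublinear p"
  shows "\<exists>q. sublinear q \<and> q \<le> p \<and> (\<forall>q'. sublinear q' \<longrightarrow> q' \<le> q \<longrightarrow> q' = q)"
proof -
  define S where "S = {q. sublinear q \<and> q \<le> p}"
  have "\<exists>m\<in>S. \<forall>a\<in>S. a \<le> m \<longrightarrow> a = m"
  \<comment> \<open>The order is reversed, so a maximal element is a minimal functional.\<close>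
  proof (rule predicate_Zorn[where P = "\<lambda>a b. b \<le> a"])
    show "partial_order_on S (relation_of (\<lambda>a b. b \<le> a) S)"
      by (auto simp: partial_order_on_def preorder_on_def refl_on_def trans_def antisym_def relation_of_def)
  next
    fix C assume C: "C \<in> Chains (relation_of (\<lambda>a b. b \<le> a) S)"
    have CS: "C \<subseteq> S" and total: "\<And>a b. a \<in> C \<Longrightarrow> b \<in> C \<Longrightarrow> a \<le> b \<or> b \<le> a"
      using C by (auto simp: Chains_def relation_of_def)
    show "\<exists>u\<in>S. \<forall>a\<in>C. u \<le> a"
    proof (cases "C = {}")
      case True
      then show ?thesis using p by (auto simp: S_def)
    next
      case False
      define u where "u x = (INF a\<in>C. a x)" for x
      have low: "- p (- x) \<le> a x" if "a \<in> C" for a x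
      proof -
        have "sublinear a" "a (- x) \<le> p (- x)" using that CS by (auto simp: S_def le_fun_def)
        then show ?thesis using sublinear_minus_le[of a x] by simp
      qed
      have u_le: "u x \<le> a x" if "a \<in> C" for a x
        unfolding u_def using that low by (intro cINF_lower bdd_belowI[of _ "- p (- x)"]) auto
      have u_ge: "c \<le> u x" if "\<And>a. a \<in> C \<Longrightarrow> c \<le> a x" for c x
        unfolding u_def using False that by (rule cINF_greatest)
      have "u (x + y) \<le> u x + u y" for x y
      proof -
        have 1: "u (x + y) \<le> a x + b y" if ab: "a \<in> C" "b \<in> C" for a b
        proof -
          \<comment> \<open>The smaller of \<open>a\<close> and \<open>b\<close> lies below both, so
            its own subadditivity suffices.\<close>
          obtain c where c: "c \<in> C" "c \<le> a" "c \<le> b"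
            using total[OF ab] ab by blast
          have "u (x + y) \<le> c (x + y)" by (rule u_le[OF c(1)])
          also have "\<dots> \<le> c x + c y" using c CS by (intro sublinear_add) (auto simp: S_def)
          also have "\<dots> \<le> a x + b y" using c by (auto simp: le_fun_def intro: add_mono)
          finally show ?thesis .
        qed
        have "u (x + y) - b y \<le> u x" if "b \<in> C" for b
          using 1 that by (intro u_ge) (simp add: algebra_simps)
        then have "u (x + y) - u x \<le> u y"
          by (intro u_ge) (simp add: algebra_simps)
        then show ?thesis by simp
      qed
      moreover have "u (r *\<^sub>R x) \<le> r * u x" if r: "r > 0" for r x
      proof -
        have "u (r *\<^sub>R x) / r \<le> u x"
        proof (rule u_ge)
          fix a assume a: "a \<in> C"
          then have "a (r *\<^sub>R x) = r * a x" using CS r by (intro sublinear_scaleR) (auto simp: S_def)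
          then show "u (r *\<^sub>R x) / r \<le> a x" using u_le[OF a, of "r *\<^sub>R x"] r by (simp add: field_simps)
        qed
        then show ?thesis using r by (simp add: field_simps)
      qed
      moreover have "u 0 = 0"
      proof -
        have "a 0 = 0" if "a \<in> C" for a using that CS by (auto simp: S_def sublinear_zero)
        then have "u 0 = (INF a\<in>C. 0)" unfolding u_def by (intro INF_cong) auto
        then show ?thesis using False by simp
      qed
      ultimately have "sublinear u" by (simp add: sublinear_def)
      moreover obtain a where a: "a \<in> C" using False by blast
      then have "u \<le> p" using u_le[OF a] CS by (force simp: S_def le_fun_def intro: order_trans)
      ultimately show ?thesis using u_le by (auto simp: S_def le_fun_def)
    qed
  qed
  then show ?thesis by (auto simp: S_def intro: order_trans)
qed

text \<open>A minimal sublinear functional \<open>q\<close>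
  cannot be lowered at \<open>- y\<close>, which forces \<open>q (- y) = - q y\<close>.\<close>

theorem mazur_orlicz:
  fixes p :: "'v::real_vector \<Rightarrow> real"
  assumes p: "sublinear p" and K: "convex K" "K \<noteq> {}" and N: "\<And>w. w \<in> K \<Longrightarrow> N \<le> p w"
  shows "\<exists>g. linear g \<and> (\<forall>x. g x \<le> p x) \<and> (\<forall>w\<in>K. N \<le> g w)"
proof -
  obtain p' where p': "sublinear p'" "\<And>x. p' x \<le> p x" "\<And>w. w \<in> K \<Longrightarrow> p' (- w) \<le> - N"
    using sublinear_lower_on_convex[OF assms] by blast
  obtain g where g: "sublinear g" "g \<le> p'" and gmin: "\<And>q. sublinear q \<Longrightarrow> q \<le> g \<Longrightarrow> q = g"
    using minimal_sublinear_exists[OF p'(1)] by blast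
  have neg: "g (- y) = - g y" for y
  proof -
    obtain q where q: "sublinear q" "\<And>x. q x \<le> g x" "q (- y) \<le> - g y"
      using sublinear_lower_on_convex[OF g(1), of "{y}" "g y"] by auto
    have "q = g" using gmin[OF q(1)] q(2) by (simp add: le_fun_def)
    then show ?thesis using q(3) sublinear_minus_le[OF g(1), of y] by simp
  qed
  \<comment> \<open>Subadditivity at \<open>x + y\<close> and \<open>- y\<close> gives the reverse
    inequality \<open>g x \<le> g (x + y) - g y\<close>.\<close>
  have add: "g (x + y) = g x + g y" for x y
    using sublinear_add[OF g(1), of x y] sublinear_add[OF g(1), of "x + y" "- y"] neg[of y] by simp
  have "g (r *\<^sub>R x) = r * g x" for r x
  proof (cases "r \<ge> 0")
    case True
    then show ?thesis by (rule sublinear_scaleR[OF g(1)])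
  next
    case False
    then show ?thesis
      using sublinear_scaleR[OF g(1), of "- r" x] neg[of "r *\<^sub>R x"] by simp
  qed
  with add have "linear g" by (intro linearI) auto
  moreover have "g x \<le> p x" for x using g(2) p'(2) by (meson le_fun_def order_trans)
  moreover have "N \<le> g w" if "w \<in> K" for w
    using p'(3)[OF that] g(2) neg[of w] by (smt (verit) le_fun_def)
  ultimately show ?thesis by blast
qed

section \<open>Spectrum and norm in a C*-algebra\<close>

lemma adj_one [simp]: "adj (1::'a::cstar_algebra) = 1"
proof -
  have "adj (adj 1 * 1) = adj 1 * (1::'a)" by (simp only: adj_mult adj_adj)
  then show ?thesis by (simp add: adj_adj)
qed

lemma cscale_zero_right [simp]: "cscale c (0::'v::cvector) = 0"
  using cscale_add_right[of c "0::'v" 0] by simp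

lemma cscale_minus_right: "cscale c (- x) = - cscale c (x::'v::cvector)"
  using cscale_add_right[of c x "- x"] by (simp add: eq_neg_iff_add_eq_0 add.commute)

lemma cscale_minus_left: "cscale (- c) x = - cscale c (x::'v::cvector)"
proof -
  have "cscale 0 x = 0" using scaleR_cscale[of 0 x] by simp
  then show ?thesis using cscale_add_left[of c "- c" x] by (simp add: eq_neg_iff_add_eq_0 add.commute)
qed

lemma cscale_scaleR: "cscale c (r *\<^sub>R x) = r *\<^sub>R cscale c (x::'v::cvector)"
  by (simp add: scaleR_cscale cscale_cscale mult.commute)

lemma adj_scaleR [simp]: "adj (r *\<^sub>R x) = r *\<^sub>R adj (x::'a::cstar_algebra)"
  by (simp add: scaleR_cscale adj_cscale)

lemma adj_minus [simp]: "adj (- x) = - adj (x::'a::cstar_algebra)"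
  using adj_scaleR[of "-1" x] by simp

lemma adj_diff [simp]: "adj (x - y) = adj x - adj (y::'a::cstar_algebra)"
  using adj_add[of x "- y"] by simp

lemma adj_of_real [simp]: "adj (of_real r :: 'a::cstar_algebra) = of_real r"
  by (simp add: of_real_def)

lemma adj_power: "adj (x ^ n) = adj (x::'a::cstar_algebra) ^ n"
  by (induction n) (simp_all add: adj_mult power_commutes)

lemma norm_adj [simp]: "norm (adj x) = norm (x::'a::cstar_algebra)"
proof -
  have "norm x \<le> norm (adj x)" for x :: 'a
  proof (cases "norm x = 0")
    case False
    have "(norm x)\<^sup>2 \<le> norm (adj x) * norm x"
      by (metis cstar_identity norm_mult_ineq)
    with False show ?thesis by (simp add: power2_eq_square)
  qed simp
  from this[of x] this[of "adj x"] show ?thesis by (simp add: adj_adj)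
qed

text \<open>Powers of \<open>a\<close> are self-adjoint, so the C*-identity squares the norm at each
  doubling of the exponent.\<close>

lemma norm_selfadjoint_power:
  assumes "adj a = (a::'a::cstar_algebra)"
  shows "norm (a ^ (2 ^ k)) = norm a ^ (2 ^ k)"
proof (induction k)
  case (Suc k)
  have "a ^ (2 ^ Suc k) = adj (a ^ 2 ^ k) * a ^ 2 ^ k"
    by (simp add: adj_power assms mult_2 power_add)
  then have "norm (a ^ (2 ^ Suc k)) = (norm (a ^ 2 ^ k))\<^sup>2" by (simp only: cstar_identity)
  then show ?case by (simp add: Suc power_mult[symmetric] mult.commute)
qed simp

lemma of_real_eq_cscale: "(of_real r :: 'a::cstar_algebra) = cscale (complex_of_real r) 1"
  by (simp add: of_real_def scaleR_cscale)

section \<open>Invertible elements and elementary spectral calculus\<close>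

lemma alg_invertible_cscale:
  assumes "alg_invertible x" "c \<noteq> 0"
  shows "alg_invertible (cscale c (x::'a::cstar_algebra))"
proof -
  obtain y where "x * y = 1" "y * x = 1" using assms by (auto simp: alg_invertible_def)
  then have "cscale c x * cscale (inverse c) y = 1" "cscale (inverse c) y * cscale c x = 1"
    using assms(2) by (auto simp: mult_cscale_left mult_cscale_right cscale_cscale cscale_one)
  then show ?thesis by (auto simp: alg_invertible_def)
qed

lemma alg_invertible_minus: "alg_invertible (- x) \<longleftrightarrow> alg_invertible (x::'a::cstar_algebra)"
  using alg_invertible_cscale[of x "-1"] alg_invertible_cscale[of "- x" "-1"]
  by (auto simp: cscale_minus_left cscale_one)

text \<open>The inverse is the Neumann series; splitting off its first term gives
  \<open>y = 1 + x * y = 1 + y * x\<close>.\<close>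

lemma alg_invertible_one_minus:
  assumes "norm (x::'a::cstar_algebra) < 1"
  shows "alg_invertible (1 - x)"
proof -
  have sm: "summable (\<lambda>n. x ^ n)" by (rule complete_algebra_summable_geometric[OF assms])
  define y where "y = (\<Sum>n. x ^ n)"
  have "y = 1 + x * y"
    using suminf_split_head[OF sm] suminf_mult[OF sm, of x] by (simp add: y_def)
  moreover have "y = 1 + y * x"
    using suminf_split_head[OF sm] suminf_mult2[OF sm, of x] by (simp add: y_def power_commutes)
  ultimately have "(1 - x) * y = 1" "y * (1 - x) = 1"
    by (simp_all add: algebra_simps)
  then show ?thesis by (auto simp: alg_invertible_def)
qed

text \<open>For \<open>cmod z > norm x\<close> the element \<open>x - z\<close> equals
  \<open>- z\<close> times \<open>1 - x / z\<close>, which the Neumann series inverts.\<close>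

lemma alg_spectrum_norm_bound:
  assumes "z \<in> alg_spectrum (x::'a::cstar_algebra)"
  shows "cmod z \<le> norm x"
proof (rule ccontr)
  assume *: "\<not> cmod z \<le> norm x"
  then have z: "z \<noteq> 0" by auto
  have "alg_invertible (1 - cscale (inverse z) x)"
    using * z by (intro alg_invertible_one_minus) (simp add: norm_cscale norm_inverse flip: divide_inverse_commute)
  then have "alg_invertible (cscale (- z) (1 - cscale (inverse z) x))"
    using z by (intro alg_invertible_cscale) auto
  also have "cscale (- z) (1 - cscale (inverse z) x) = x - cscale z 1"
    using z cscale_add_right[of "-z" 1 "- cscale (inverse z) x"]
    by (simp add: cscale_minus_right cscale_minus_left cscale_cscale cscale_one)
  finally show False using assms by (simp add: alg_spectrum_def)
qed

lemma alg_spectrum_of_real_add: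
  "z \<in> alg_spectrum (of_real t + x) \<longleftrightarrow> z - of_real t \<in> alg_spectrum (x::'a::cstar_algebra)"
proof -
  have "of_real t + x - cscale z 1 = x - cscale (z - of_real t) 1"
    using cscale_add_left[of z "- of_real t" "1::'a"]
    by (simp add: of_real_eq_cscale cscale_minus_left)
  then show ?thesis unfolding alg_spectrum_def mem_Collect_eq by (simp only:)
qed

lemma alg_spectrum_of_real_diff:
  "z \<in> alg_spectrum (of_real t - x) \<longleftrightarrow> of_real t - z \<in> alg_spectrum (x::'a::cstar_algebra)"
proof -
  have "of_real t - x - cscale z 1 = - (x - cscale (of_real t - z) 1)"
    using cscale_add_left[of "of_real t" "- z" "1::'a"]
    by (simp add: of_real_eq_cscale cscale_minus_left)
  then show ?thesis unfolding alg_spectrum_def mem_Collect_eq by (simp only: alg_invertible_minus)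
qed

section \<open>Spectral radius of a self-adjoint element\<close>

text \<open>Rickart's elementary route to the spectral radius, restricted to the exponents \<open>2 ^ k\<close>.
  If the resolvent \<open>G z = (1 - z a)\<^sup>-\<^sup>1\<close> existed on the whole closed unit disc, then
  averaging it over the \<open>2 ^ k\<close>-th roots of unity would give \<open>(1 - z ^ 2 ^ k a ^ 2 ^ k)\<^sup>-\<^sup>1\<close>.
  Averaging preserves the Lipschitz estimate between \<open>z\<close> and \<open>\<rho> z\<close> for \<open>\<rho> < 1\<close>, so
  \<open>(1 - a ^ 2 ^ k)\<^sup>-\<^sup>1\<close> is eventually close to 1, contradicting \<open>norm (a ^ 2 ^ k) = 1\<close>.\<close>

lemma resolvent_lipschitz:
  fixes a :: "'a::cstar_algebra" and G :: "complex \<Rightarrow> 'a"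
  assumes G: "\<And>z. cmod z \<le> 1 \<Longrightarrow> (1 - cscale z a) * G z = 1 \<and> G z * (1 - cscale z a) = 1"
  shows "\<exists>L. \<forall>z w. cmod z \<le> 1 \<longrightarrow> cmod w \<le> 1 \<longrightarrow> norm (G z - G w) \<le> L * cmod (z - w)"
proof -
  \<comment> \<open>Resolvent identity, obtained by inserting \<open>(1 - w a) G w = 1\<close> and
    \<open>G z (1 - z a) = 1\<close>.\<close>
  have res: "G z - G w = cscale (z - w) (G z * a * G w)" if "cmod z \<le> 1" "cmod w \<le> 1" for z w
  proof -
    have "G z - G w = G z * ((1 - cscale w a) * G w) - (G z * (1 - cscale z a)) * G w"
      using G that by simp
    also have "\<dots> = G z * (cscale z a - cscale w a) * G w"
      by (simp add: algebra_simps)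
    also have "cscale z a - cscale w a = cscale (z - w) a"
      using cscale_add_left[of z "- w" a] by (simp add: cscale_minus_left)
    finally show ?thesis by (simp add: mult_cscale_left mult_cscale_right)
  qed
  have ineq: "norm (G z - G w) \<le> cmod (z - w) * (norm (G z) * norm a * norm (G w))"
    if "cmod z \<le> 1" "cmod w \<le> 1" for z w
  proof -
    have "norm (G z * a * G w) \<le> norm (G z) * norm a * norm (G w)"
      by (meson mult_right_mono norm_ge_zero norm_mult_ineq order_trans)
    then show ?thesis using res[OF that] by (simp add: norm_cscale mult_left_mono)
  qed
  \<comment> \<open>Continuity gives boundedness on the compact disc, and a bound on
    \<open>G\<close> turns \<open>ineq\<close> into a uniform Lipschitz estimate.\<close>
  have cont: "continuous_on (cball 0 1) G"
    unfolding continuous_on_iff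
  proof (intro ballI allI impI)
    fix z :: complex and \<epsilon> :: real assume z: "z \<in> cball 0 1" and \<epsilon>: "\<epsilon> > 0"
    define c where "c = norm (G z) * norm a + 1"
    have c: "c > 0" by (simp add: c_def add_nonneg_pos)
    define m where "m = 2 * norm (G z) + 1"
    have m: "m > 0" by (simp add: m_def add_nonneg_pos)
    \<comment> \<open>The first bound yields \<open>norm (G w) \<le> 2 * norm (G z) < m\<close>;
      with this, the second makes the difference smaller than \<open>\<epsilon>\<close>.\<close>
    define d where "d = min (1 / (2 * c)) (\<epsilon> / (c * m))"
    show "\<exists>d>0. \<forall>w\<in>cball 0 1. dist w z < d \<longrightarrow> dist (G w) (G z) < \<epsilon>"
    proof (intro exI conjI ballI impI)
      show "d > 0" using c m \<epsilon> by (simp add: d_def)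
      fix w assume w: "w \<in> cball 0 1" "dist w z < d"
      have dz: "cmod (z - w) < d" using w by (simp add: dist_norm norm_minus_commute)
      have "norm (G z - G w) \<le> cmod (z - w) * (norm (G z) * norm a * norm (G w))"
        using ineq z w by simp
      also have "\<dots> \<le> cmod (z - w) * (c * norm (G w))"
        by (intro mult_left_mono mult_right_mono) (auto simp: c_def)
      finally have 1: "norm (G z - G w) \<le> (cmod (z - w) * c) * norm (G w)" by (simp add: mult_ac)
      have "cmod (z - w) * c \<le> 1 / 2" using dz c by (simp add: d_def field_simps)
      then have "norm (G z - G w) \<le> 1 / 2 * norm (G w)"
        using 1 by (meson mult_right_mono norm_ge_zero order_trans)
      then have "norm (G w) < m"
        using norm_triangle_ineq2[of "G w" "G z"] by (simp add: m_def norm_minus_commute)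
      then have "(cmod (z - w) * c) * norm (G w) \<le> (cmod (z - w) * c) * m"
        using c by (intro mult_left_mono) auto
      moreover have "(cmod (z - w) * c) * m < \<epsilon>" using dz c m by (simp add: d_def field_simps)
      ultimately show "dist (G w) (G z) < \<epsilon>" using 1 by (simp add: dist_norm norm_minus_commute)
    qed
  qed
  have "bounded (G ` cball 0 1)"
    by (intro compact_imp_bounded compact_continuous_image cont) auto
  then obtain M where M: "M > 0" "\<And>z. cmod z \<le> 1 \<Longrightarrow> norm (G z) \<le> M"
    unfolding bounded_pos by fastforce
  have "norm (G z - G w) \<le> (M * norm a * M) * cmod (z - w)" if "cmod z \<le> 1" "cmod w \<le> 1" for z w
  proof -
    have "norm (G z) * norm a * norm (G w) \<le> M * norm a * M"
      using M that by (intro mult_mono) auto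
    then show ?thesis
      using ineq[OF that] by (smt (verit) mult.commute mult_left_mono norm_ge_zero)
  qed
  then show ?thesis by blast
qed

text \<open>Since \<open>T - 1 = T * x\<close>, the bound on \<open>x\<close> gives
  \<open>norm T \<le> 1 + norm T / 2\<close>, hence \<open>norm T \<le> 2\<close>, which is fed back
  into \<open>T * x\<close>.\<close>

lemma inverse_near_one:
  fixes x T :: "'a::real_normed_algebra_1"
  assumes "T * (1 - x) = 1" "norm x \<le> 1 / 2"
  shows "norm (T - 1) \<le> 2 * norm x"
proof -
  have eq: "T - 1 = T * x" using assms(1) by (simp add: algebra_simps)
  then have 1: "norm (T - 1) \<le> norm T * norm x" by (metis norm_mult_ineq)
  also have "\<dots> \<le> norm T * (1 / 2)" using assms(2) by (intro mult_left_mono) auto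
  finally have "norm T \<le> 2" using norm_triangle_ineq2[of T 1] by simp
  then have "norm T * norm x \<le> 2 * norm x" by (intro mult_right_mono) auto
  then show ?thesis using 1 by simp
qed

text \<open>With \<open>\<zeta> ^ 2 ^ k = - 1\<close>, passing from \<open>z\<close> to
  \<open>\<zeta> * z\<close> flips the sign of \<open>x = z ^ 2 ^ k a ^ 2 ^ k\<close>. The average
  of the inverses of \<open>1 - x\<close> and \<open>1 + x\<close> inverts \<open>1 - x * x\<close>,
  and averaging leaves the bound \<open>\<epsilon>\<close> independent of \<open>k\<close>.\<close>

lemma inverse_pow2_lipschitz:
  fixes a :: "'a::cstar_algebra" and G :: "complex \<Rightarrow> 'a"
  assumes G: "\<And>z. cmod z \<le> 1 \<Longrightarrow> (1 - cscale z a) * G z = 1 \<and> G z * (1 - cscale z a) = 1"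
    and L: "\<And>z. cmod z = 1 \<Longrightarrow> norm (G z - G (of_real \<rho> * z)) \<le> \<epsilon>"
  shows "\<exists>T. (\<forall>z. cmod z \<le> 1 \<longrightarrow> (1 - cscale (z ^ 2 ^ k) (a ^ 2 ^ k)) * T z = 1
               \<and> T z * (1 - cscale (z ^ 2 ^ k) (a ^ 2 ^ k)) = 1) \<and>
             (\<forall>z. cmod z = 1 \<longrightarrow> norm (T z - T (of_real \<rho> * z)) \<le> \<epsilon>)"
proof (induction k)
  case 0
  then show ?case using G L by (intro exI[of _ G]) auto
next
  case (Suc k)
  then obtain T where T: "\<And>z. cmod z \<le> 1 \<Longrightarrow> (1 - cscale (z ^ 2 ^ k) (a ^ 2 ^ k)) * T z = 1"
      "\<And>z. cmod z \<le> 1 \<Longrightarrow> T z * (1 - cscale (z ^ 2 ^ k) (a ^ 2 ^ k)) = 1"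
    and TL: "\<And>z. cmod z = 1 \<Longrightarrow> norm (T z - T (of_real \<rho> * z)) \<le> \<epsilon>" by blast
  define \<zeta> where "\<zeta> = cis (pi / 2 ^ k)"
  have \<zeta>: "\<zeta> ^ 2 ^ k = - 1" "cmod \<zeta> = 1"
    using Complex.DeMoivre[of "pi / 2 ^ k" "2 ^ k"] by (simp_all add: \<zeta>_def)
  define T' where "T' z = (1/2) *\<^sub>R (T z + T (\<zeta> * z))" for z
  have "(1 - cscale (z ^ 2 ^ Suc k) (a ^ 2 ^ Suc k)) * T' z = 1 \<and>
        T' z * (1 - cscale (z ^ 2 ^ Suc k) (a ^ 2 ^ Suc k)) = 1" if z: "cmod z \<le> 1" for z
  proof -
    define x where "x = cscale (z ^ 2 ^ k) (a ^ 2 ^ k)"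
    have 1: "(1 - x) * T z = 1" "T z * (1 - x) = 1" using T[OF z] by (simp_all add: x_def)
    have "cmod (\<zeta> * z) \<le> 1" using z \<zeta> by (simp add: norm_mult)
    from T[OF this] have 2: "(1 + x) * T (\<zeta> * z) = 1" "T (\<zeta> * z) * (1 + x) = 1"
      by (simp_all add: x_def power_mult_distrib \<zeta> cscale_minus_left)
    have "cscale (z ^ 2 ^ Suc k) (a ^ 2 ^ Suc k) = x * x"
      by (simp add: x_def mult_cscale_left mult_cscale_right cscale_cscale mult_2 power_add)
    then have e: "1 - cscale (z ^ 2 ^ Suc k) (a ^ 2 ^ Suc k) = (1 + x) * (1 - x)"
         "(1 + x) * (1 - x) = (1 - x) * (1 + x)"
      by (simp_all add: algebra_simps)
    have "(1 + x) * (1 - x) * (T z + T (\<zeta> * z)) = (1 + x) * ((1 - x) * T z) + (1 - x) * ((1 + x) * T (\<zeta> * z))"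
      unfolding distrib_left[of "(1 + x) * (1 - x)"] by (simp only: e(2) mult.assoc[symmetric])
    also have "\<dots> = 2 *\<^sub>R 1" by (simp add: 1 2 scaleR_2)
    finally have 3: "(1 + x) * (1 - x) * (T z + T (\<zeta> * z)) = 2 *\<^sub>R 1" .
    have "(T z + T (\<zeta> * z)) * ((1 + x) * (1 - x)) = (T z * (1 - x)) * (1 + x) + (T (\<zeta> * z) * (1 + x)) * (1 - x)"
      unfolding distrib_right[of "T z"] by (simp only: e(2) mult.assoc)
    also have "\<dots> = 2 *\<^sub>R 1" by (simp add: 1 2 scaleR_2)
    finally have 4: "(T z + T (\<zeta> * z)) * ((1 + x) * (1 - x)) = 2 *\<^sub>R 1" .
    show ?thesis unfolding e(1) T'_def using 3 4 by simp
  qed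
  moreover have "norm (T' z - T' (of_real \<rho> * z)) \<le> \<epsilon>" if z: "cmod z = 1" for z
  proof -
    have "T' z - T' (of_real \<rho> * z) =
        (1/2) *\<^sub>R ((T z - T (of_real \<rho> * z)) + (T (\<zeta> * z) - T (of_real \<rho> * (\<zeta> * z))))"
      by (simp add: T'_def mult.left_commute scaleR_right_diff_distrib scaleR_right_distrib)
    moreover have "norm ((T z - T (of_real \<rho> * z)) + (T (\<zeta> * z) - T (of_real \<rho> * (\<zeta> * z)))) \<le> \<epsilon> + \<epsilon>"
      using TL[of z] TL[of "\<zeta> * z"] z \<zeta> by (intro norm_triangle_le) (simp add: norm_mult)
    ultimately show ?thesis by simp
  qed
  ultimately show ?case by blast
qed

lemma selfadjoint_unit_resolvent_fails:
  fixes a :: "'a::cstar_algebra"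
  assumes a: "adj a = a" "norm a = 1"
  shows "\<exists>z. cmod z \<le> 1 \<and> \<not> alg_invertible (1 - cscale z a)"
proof (rule ccontr)
  assume "\<not> ?thesis"
  then have "\<forall>z. \<exists>y. cmod z \<le> 1 \<longrightarrow> (1 - cscale z a) * y = 1 \<and> y * (1 - cscale z a) = 1"
    by (auto simp: alg_invertible_def)
  then obtain G where G: "\<And>z. cmod z \<le> 1 \<Longrightarrow> (1 - cscale z a) * G z = 1 \<and> G z * (1 - cscale z a) = 1"
    by metis
  from resolvent_lipschitz[OF G] obtain L
    where L: "\<And>z w. cmod z \<le> 1 \<Longrightarrow> cmod w \<le> 1 \<Longrightarrow> norm (G z - G w) \<le> L * cmod (z - w)"
    by blast
  \<comment> \<open>\<open>\<rho>\<close> is so close to 1 that the Lipschitz estimate costs at most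
    1/8; the \<open>+ 1\<close> covers \<open>L = 0\<close>.\<close>
  define \<rho> where "\<rho> = 1 - 1 / (8 * (\<bar>L\<bar> + 1))"
  have \<rho>: "0 \<le> \<rho>" "\<rho> < 1" "\<bar>L\<bar> * (1 - \<rho>) \<le> 1 / 8"
    by (simp_all add: \<rho>_def field_simps)
  have "norm (G z - G (of_real \<rho> * z)) \<le> 1 / 8" if z: "cmod z = 1" for z
  proof -
    have "z - of_real \<rho> * z = of_real (1 - \<rho>) * z" by (simp add: algebra_simps)
    then have "cmod (z - of_real \<rho> * z) = 1 - \<rho>" using z \<rho> by (simp add: norm_mult flip: of_real_diff)
    moreover have "cmod (of_real \<rho> * z) \<le> 1" using z \<rho> by (simp add: norm_mult)
    ultimately have "norm (G z - G (of_real \<rho> * z)) \<le> L * (1 - \<rho>)"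
      using L[of z "of_real \<rho> * z"] z by simp
    also have "\<dots> \<le> \<bar>L\<bar> * (1 - \<rho>)" using \<rho> by (intro mult_right_mono) auto
    finally show ?thesis using \<rho> by simp
  qed
  note P = inverse_pow2_lipschitz[of a G \<rho> "1/8", OF G this]
  have "(\<lambda>n. \<rho> ^ n) \<longlonglongrightarrow> 0" using \<rho> by (intro LIMSEQ_realpow_zero) auto
  then obtain n0 where n0: "\<And>n. n \<ge> n0 \<Longrightarrow> \<rho> ^ n < 1 / 16"
    using order_tendstoD(2)[of _ 0 _ "1 / 16"] by (force simp: eventually_sequentially)
  define k where "k = n0"
  \<comment> \<open>The choice \<open>k = n0\<close> works because
    \<open>n0 < 2 ^ n0\<close>.\<close>
  have small: "\<rho> ^ 2 ^ k < 1 / 16" using n0[of "2 ^ k"] by (simp add: k_def less_imp_le)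
  obtain T where T: "\<And>z. cmod z \<le> 1 \<Longrightarrow> (1 - cscale (z ^ 2 ^ k) (a ^ 2 ^ k)) * T z = 1"
      "\<And>z. cmod z \<le> 1 \<Longrightarrow> T z * (1 - cscale (z ^ 2 ^ k) (a ^ 2 ^ k)) = 1"
    and TL: "\<And>z. cmod z = 1 \<Longrightarrow> norm (T z - T (of_real \<rho> * z)) \<le> 1 / 8"
    using P[of k] by blast
  define x where "x = a ^ 2 ^ k"
  have nx: "norm x = 1" using norm_selfadjoint_power[OF a(1), of k] a(2) by (simp add: x_def)
  have nr: "norm (cscale (of_real \<rho> ^ 2 ^ k) x) = \<rho> ^ 2 ^ k"
    using \<rho> by (simp add: norm_cscale nx norm_power)
  have "norm (T (of_real \<rho>) - 1) \<le> 2 * norm (cscale (of_real \<rho> ^ 2 ^ k) x)"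
    using \<rho> small T(2)[of "of_real \<rho>"] nr by (intro inverse_near_one) (auto simp: x_def)
  then have "norm (T (of_real \<rho>) - 1) \<le> 1 / 8" using small nr by simp
  moreover have "norm (T 1 - T (of_real \<rho>)) \<le> 1 / 8" using TL[of 1] by simp
  ultimately have d: "norm (T 1 - 1) \<le> 1 / 4"
    using norm_triangle_ineq[of "T 1 - T (of_real \<rho>)" "T (of_real \<rho>) - 1"] by simp
  have "(1 - x) * T 1 = 1" using T(1)[of 1] by (simp add: x_def cscale_one)
  \<comment> \<open>Written this way, \<open>norm x = 1\<close> and
    \<open>norm (T 1 - 1) \<le> 1 / 4\<close> give the contradiction
    \<open>1 \<le> 1 / 2\<close>.\<close>
  then have "x = (T 1 - 1) - x * (T 1 - 1)" by (simp add: algebra_simps)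
  then have "norm x \<le> norm (T 1 - 1) + norm (x * (T 1 - 1))" by (metis norm_triangle_ineq4)
  also have "\<dots> \<le> norm (T 1 - 1) + norm x * norm (T 1 - 1)" by (simp add: norm_mult_ineq)
  finally show False using d nx by simp
qed

text \<open>After scaling to norm 1, a failure of \<open>1 - w b\<close> to be invertible with
  \<open>cmod w \<le> 1\<close> puts \<open>norm a / w\<close> into the spectrum, a point of modulus
  at least \<open>norm a\<close>.\<close>

theorem selfadjoint_spectrum_attains_norm:
  fixes a :: "'a::cstar_algebra"
  assumes "adj a = a"
  shows "\<exists>z\<in>alg_spectrum a. norm a \<le> cmod z"
proof (cases "a = 0")
  case True
  have "\<not> alg_invertible (0::'a)" by (simp add: alg_invertible_def)
  then have "0 \<in> alg_spectrum a"
    using scaleR_cscale[of 0 "1::'a"] by (simp add: alg_spectrum_def True)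
  then show ?thesis using True by auto
next
  case False
  define b where "b = inverse (norm a) *\<^sub>R a"
  have "adj b = b" "norm b = 1" using assms False by (simp_all add: b_def)
  then obtain w where w: "cmod w \<le> 1" "\<not> alg_invertible (1 - cscale w b)"
    using selfadjoint_unit_resolvent_fails by blast
  have w0: "w \<noteq> 0"
  proof
    assume "w = 0"
    then have "1 - cscale w b = 1" using scaleR_cscale[of 0 b] by simp
    then show False using w(2) by (auto simp: alg_invertible_def)
  qed
  define z where "z = of_real (norm a) / w"
  have z0: "z \<noteq> 0" using w0 False by (simp add: z_def)
  have "cscale (- inverse z) (a - cscale z 1) = 1 - cscale (inverse z) a"
    using z0 cscale_add_right[of "- inverse z" a "- cscale z 1"]
    by (simp add: cscale_minus_right cscale_minus_left cscale_cscale cscale_one)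
  also have "cscale (inverse z) a = cscale w b"
    using False w0 by (simp add: b_def z_def scaleR_cscale cscale_cscale divide_simps)
  finally have "\<not> alg_invertible (a - cscale z 1)"
    using w(2) alg_invertible_cscale[of "a - cscale z 1" "- inverse z"] z0 by auto
  moreover have "norm a \<le> cmod z" using w w0 by (simp add: z_def norm_divide field_simps mult_left_le)
  ultimately show ?thesis by (auto simp: alg_spectrum_def)
qed

section \<open>Norms and spectra of positive elements\<close>

lemma positive_norm_in_spectrum:
  assumes "positive_elem (c::'a::cstar_algebra)"
  shows "of_real (norm c) \<in> alg_spectrum c"
proof -
  obtain z where z: "z \<in> alg_spectrum c" "norm c \<le> cmod z"
    using assms selfadjoint_spectrum_attains_norm by (auto simp: positive_elem_def)
  then have "Im z = 0" "0 \<le> Re z" "cmod z = norm c"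
    using assms alg_spectrum_norm_bound[OF z(1)] by (auto simp: positive_elem_def)
  then have "z = of_real (norm c)" by (auto simp: complex_eq_iff cmod_def)
  then show ?thesis using z by simp
qed

lemma positive_norm_add_ge:
  assumes "positive_elem (c::'a::cstar_algebra)"
  shows "t + norm c \<le> norm (of_real t + c)"
proof -
  have "of_real (t + norm c) \<in> alg_spectrum (of_real t + c)"
    using positive_norm_in_spectrum[OF assms] by (simp add: alg_spectrum_of_real_add)
  from alg_spectrum_norm_bound[OF this] show ?thesis by (simp only: norm_of_real)
qed

lemma norm_minus_positive_spectrum:
  assumes "positive_elem (c::'a::cstar_algebra)" "z \<in> alg_spectrum (of_real (norm c) - c)"
  shows "Im z = 0" "0 \<le> Re z" "Re z \<le> norm c"
proof -
  have *: "of_real (norm c) - z \<in> alg_spectrum c" using assms(2) by (simp add: alg_spectrum_of_real_diff)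
  then have "Im (of_real (norm c) - z) = 0 \<and> 0 \<le> Re (of_real (norm c) - z)"
    using assms(1) by (auto simp: positive_elem_def simp del: complex_Re_of_int)
  moreover have "\<bar>Re (of_real (norm c) - z)\<bar> \<le> norm c"
    using alg_spectrum_norm_bound[OF *] abs_Re_le_cmod order_trans by blast
  ultimately show "Im z = 0" "0 \<le> Re z" "Re z \<le> norm c" by auto
qed

lemma positive_norm_minus:
  "positive_elem (c::'a::cstar_algebra) \<Longrightarrow> positive_elem (of_real (norm c) - c)"
  using norm_minus_positive_spectrum by (auto simp: positive_elem_def)

text \<open>The norm is bounded by the modulus of some spectral point, and the spectrum of this
  element lies in the interval from 0 to \<open>norm c\<close>.\<close>

lemma norm_norm_minus_positive:
  assumes "positive_elem (c::'a::cstar_algebra)"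
  shows "norm (of_real (norm c) - c) \<le> norm c"
proof -
  obtain z where z: "z \<in> alg_spectrum (of_real (norm c) - c)" "norm (of_real (norm c) - c) \<le> cmod z"
    using selfadjoint_spectrum_attains_norm[of "of_real (norm c) - c"] assms
    by (auto simp: positive_elem_def)
  then show ?thesis using norm_minus_positive_spectrum[OF assms z(1)] by (simp add: cmod_def)
qed

section \<open>States dominated by the upper bound of the numerical range\<close>

text \<open>For self-adjoint \<open>x\<close> this is the largest point of the spectrum; written through the norm,
  its sublinearity needs no order structure on the algebra.\<close>

definition upper_fun :: "'a::cstar_algebra \<Rightarrow> real" where
  "upper_fun x = (INF t. norm (of_real t + x) - t)"

lemma upper_fun_le: "upper_fun x \<le> norm (of_real t + x) - t"
  unfolding upper_fun_def
proof (rule cINF_lower)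
  show "bdd_below (range (\<lambda>t. norm (of_real t + x) - t))"
  proof (rule bdd_belowI2)
    fix t show "- norm x \<le> norm (of_real t + x) - t"
      using norm_triangle_ineq2[of "of_real t :: 'a" "- x"] by simp
  qed
qed simp

lemma upper_fun_ge: "(\<And>t. c \<le> norm (of_real t + x) - t) \<Longrightarrow> c \<le> upper_fun x"
  unfolding upper_fun_def by (rule cINF_greatest) auto

lemma upper_fun_le_norm: "upper_fun x \<le> norm x"
  using upper_fun_le[of x 0] by simp

lemma sublinear_upper_fun: "sublinear (upper_fun :: 'a::cstar_algebra \<Rightarrow> real)"
  unfolding sublinear_def
proof (intro conjI allI impI)
  fix x y :: 'a
  have 1: "upper_fun (x + y) \<le> (norm (of_real t + x) - t) + (norm (of_real s + y) - s)" for s t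
    using upper_fun_le[of "x + y" "t + s"] norm_triangle_ineq[of "of_real t + x" "of_real s + y"]
    by (simp add: algebra_simps)
  have "upper_fun (x + y) - (norm (of_real s + y) - s) \<le> upper_fun x" for s
    using 1 by (intro upper_fun_ge) (simp add: algebra_simps)
  then have "upper_fun (x + y) - upper_fun x \<le> upper_fun y"
    by (intro upper_fun_ge) (smt (verit))
  then show "upper_fun (x + y) \<le> upper_fun x + upper_fun y" by simp
next
  fix r :: real and x :: 'a assume r: "r > 0"
  have "upper_fun (r *\<^sub>R x) / r \<le> upper_fun x"
  proof (rule upper_fun_ge)
    fix t
    have "of_real (r * t) + r *\<^sub>R x = r *\<^sub>R (of_real t + x)"
      by (simp add: of_real_def scaleR_add_right)
    then have "norm (of_real (r * t) + r *\<^sub>R x) = r * norm (of_real t + x)"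
      using r by simp
    then have "upper_fun (r *\<^sub>R x) \<le> r * (norm (of_real t + x) - t)"
      using upper_fun_le[of "r *\<^sub>R x" "r * t"] by (simp add: right_diff_distrib)
    then show "upper_fun (r *\<^sub>R x) / r \<le> norm (of_real t + x) - t"
      using r by (simp add: field_simps)
  qed
  then show "upper_fun (r *\<^sub>R x) \<le> r * upper_fun x" using r by (simp add: field_simps)
next
  show "upper_fun (0::'a) = 0"
    using upper_fun_le_norm[of "0::'a"] upper_fun_ge[of 0 "0::'a"] by simp
qed

text \<open>The involution is isometric and fixes real scalars. This later lets
  \<open>ip f x\<close> be treated like \<open>ip x f\<close>.\<close>

lemma upper_fun_adj: "upper_fun (adj x) = upper_fun (x::'a::cstar_algebra)"
proof -
  have "norm (of_real t + adj x) = norm (of_real t + x)" for t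
    using norm_adj[of "of_real t + x"] by (simp add: adj_add del: norm_adj)
  then show ?thesis by (simp add: upper_fun_def)
qed

lemma upper_fun_positive: "positive_elem c \<Longrightarrow> upper_fun c = norm (c::'a::cstar_algebra)"
  using upper_fun_le_norm[of c] positive_norm_add_ge[of c]
  by (intro antisym upper_fun_ge) (simp_all add: algebra_simps)

lemma upper_fun_minus_positive: "positive_elem c \<Longrightarrow> upper_fun (- c) \<le> (0::real)"
  using upper_fun_le[of "- c" "norm c"] norm_norm_minus_positive[of c] by simp

text \<open>By the C*-identity \<open>norm (t + \<i> c)\<close> is at most the square root of
  \<open>t\<^sup>2 + (norm c)\<^sup>2\<close>, which exceeds \<open>t\<close> by an amount tending
  to 0 as \<open>t\<close> grows.\<close>

lemma upper_fun_ii_selfadjoint: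
  fixes c :: "'a::cstar_algebra"
  assumes "adj c = c"
  shows "upper_fun (cscale \<i> c) \<le> 0"
proof (rule field_le_epsilon)
  fix \<epsilon> :: real assume \<epsilon>: "\<epsilon> > 0"
  \<comment> \<open>Chosen so that \<open>(norm c)\<^sup>2 = t * \<epsilon>\<close>, which fits
    under \<open>(t + \<epsilon>)\<^sup>2\<close>.\<close>
  define t where "t = (norm c)\<^sup>2 / \<epsilon>"
  have t: "t \<ge> 0" using \<epsilon> by (simp add: t_def)
  let ?x = "of_real t + cscale \<i> c"
  have "adj ?x = t *\<^sub>R 1 - cscale \<i> c"
    using assms by (simp add: adj_add adj_cscale cscale_minus_left of_real_def)
  then have "adj ?x * ?x = (t *\<^sub>R 1 - cscale \<i> c) * (t *\<^sub>R 1 + cscale \<i> c)"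
    by (simp add: of_real_def)
  also have "\<dots> = (t * t) *\<^sub>R 1 - cscale \<i> c * cscale \<i> c"
    by (simp add: distrib_left left_diff_distrib scaleR_diff_right)
  also have "cscale \<i> c * cscale \<i> c = - (c * c)"
    by (simp add: mult_cscale_left mult_cscale_right cscale_cscale cscale_minus_left cscale_one)
  finally have "adj ?x * ?x = of_real (t\<^sup>2) + c * c"
    by (simp add: of_real_def power2_eq_square)
  then have "(norm ?x)\<^sup>2 = norm (of_real (t\<^sup>2) + c * c)" by (metis cstar_identity)
  also have "\<dots> \<le> norm (of_real (t\<^sup>2) :: 'a) + norm (c * c)" by (rule norm_triangle_ineq)
  also have "\<dots> \<le> t\<^sup>2 + (norm c)\<^sup>2"
    using norm_mult_ineq[of c c] by (simp add: norm_of_real power2_eq_square del: of_real_mult)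
  also have "(norm c)\<^sup>2 = t * \<epsilon>" using \<epsilon> by (simp add: t_def)
  also have "t\<^sup>2 + t * \<epsilon> \<le> (t + \<epsilon>)\<^sup>2" using t \<epsilon> by (simp add: power2_eq_square algebra_simps)
  finally have "norm ?x \<le> t + \<epsilon>" using t \<epsilon> by (simp add: power2_le_iff_abs_le)
  then show "upper_fun (cscale \<i> c) \<le> 0 + \<epsilon>" using upper_fun_le[of "cscale \<i> c" t] by simp
qed

text \<open>This is the complex-linear functional with real part \<open>g\<close>. Domination makes
  \<open>g\<close> vanish on \<open>\<i> c\<close> for self-adjoint \<open>c\<close>, so the values
  there are real, and \<open>upper_fun (- c) \<le> 0\<close> gives positivity.\<close>

lemma state_of_dominated_functional:
  fixes g :: "'a::cstar_algebra \<Rightarrow> real"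
  assumes lin: "linear g" and le: "\<And>x. g x \<le> upper_fun x"
  shows "is_state (\<lambda>x. Complex (g x) (- g (cscale \<i> x)))"
proof -
  have add: "g (x + y) = g x + g y" for x y using lin by (rule linear_add)
  have scl: "g (r *\<^sub>R x) = r * g x" for r x using linear_scale[OF lin] by simp
  have neg: "g (- x) = - g x" for x using lin by (rule linear_neg)
  have im: "g (cscale \<i> c) = 0" if "adj c = c" for c
    using le[of "cscale \<i> c"] le[of "cscale \<i> (- c)"] upper_fun_ii_selfadjoint[of c]
      upper_fun_ii_selfadjoint[of "- c"] that neg[of "cscale \<i> c"]
    by (simp add: cscale_minus_right)
  have ri: "cscale a x = Re a *\<^sub>R x + Im a *\<^sub>R cscale \<i> x" for a and x :: 'a
    by (subst complex_eq[of a]) (simp add: cscale_add_left cscale_cscale scaleR_cscale mult.commute)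
  \<comment> \<open>The parameter 0 bounds \<open>upper_fun 1\<close> by 1; the parameter 1 bounds
    \<open>upper_fun (- 1)\<close> by -1.\<close>
  have one: "g 1 = 1"
    using le[of 1] le[of "- 1"] upper_fun_le[of "1::'a" 0] upper_fun_le[of "- 1 :: 'a" 1] neg[of 1] by simp
  have pos: "0 \<le> g c" if "positive_elem c" for c
    using le[of "- c"] upper_fun_minus_positive[OF that] neg[of c] by simp
  have cscl: "Complex (g (cscale a x)) (- g (cscale \<i> (cscale a x))) = a * Complex (g x) (- g (cscale \<i> x))" for a x
  proof -
    have "g (cscale a x) = Re a * g x + Im a * g (cscale \<i> x)"
      by (subst ri) (simp add: add scl)
    moreover have "cscale \<i> (cscale \<i> x) = - x" by (simp add: cscale_cscale cscale_minus_left cscale_one)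
    then have "cscale \<i> (cscale a x) = Re a *\<^sub>R cscale \<i> x + Im a *\<^sub>R (- x)"
      by (subst ri[of a x]) (simp only: cscale_add_right cscale_scaleR)
    then have "g (cscale \<i> (cscale a x)) = Re a * g (cscale \<i> x) - Im a * g x"
      by (simp only: add scl neg)
    ultimately show ?thesis by (simp add: complex_eq_iff)
  qed
  show ?thesis
    unfolding is_state_def
  proof (intro conjI allI impI)
    show "Complex (g (cscale a x)) (- g (cscale \<i> (cscale a x))) =
        a * Complex (g x) (- g (cscale \<i> x))" for a x
      by (rule cscl)
  qed (simp_all add: add cscale_add_right im one pos positive_elem_def complex_eq_iff)
qed

text \<open>The state is nonnegative on the positive element \<open>norm c - c\<close> and maps the
  scalar \<open>norm c\<close> to itself.\<close>

lemma state_positive_le_norm: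
  assumes "is_state \<phi>" "positive_elem c"
  shows "Re (\<phi> c) \<le> norm c"
proof -
  have add: "\<phi> (x + y) = \<phi> x + \<phi> y" and scl: "\<phi> (cscale a x) = a * \<phi> x" for x y a
    using assms(1) by (auto simp: is_state_def)
  have "0 \<le> Re (\<phi> (of_real (norm c) - c))"
    using assms(1) positive_norm_minus[OF assms(2)] unfolding is_state_def by blast
  moreover have "\<phi> (of_real (norm c) - c) + \<phi> c = of_real (norm c)"
    using assms(1) by (simp flip: add) (simp add: of_real_eq_cscale scl is_state_def)
  then have "Re (\<phi> (of_real (norm c) - c)) + Re (\<phi> c) = norm c"
    by (metis Re_complex_of_real plus_complex.sel(1))
  ultimately show ?thesis by simp
qed

section \<open>Hilbert modules and best approximations\<close>

lemma
  assumes "hilbert_module act ip"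
  shows ip_add_right: "ip x (y + z) = ip x y + ip x z"
    and ip_cscale_right: "ip x (cscale c y) = cscale c (ip x y)"
    and ip_adj: "adj (ip x y) = ip y x"
    and ip_positive: "positive_elem (ip x x)"
    and ip_add_left: "ip (x + y) z = ip x z + ip y z"
    and ip_cscale_left: "ip (cscale c x) y = cscale (cnj c) (ip x y)"
    and ip_scaleR_right: "ip x (r *\<^sub>R y) = r *\<^sub>R ip x y"
    and ip_scaleR_left: "ip (r *\<^sub>R x) y = r *\<^sub>R ip x y"
proof -
  show add: "\<And>x y z. ip x (y + z) = ip x y + ip x z"
    and scl: "\<And>x y c. ip x (cscale c y) = cscale c (ip x y)"
    and adj: "\<And>x y. adj (ip x y) = ip y x"
    and "positive_elem (ip x x)"
    using assms unfolding hilbert_module_def by metis+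
  show "ip (x + y) z = ip x z + ip y z" by (metis add adj adj_add)
  show left: "\<And>c x y. ip (cscale c x) y = cscale (cnj c) (ip x y)" by (metis scl adj adj_cscale)
  show "ip x (r *\<^sub>R y) = r *\<^sub>R ip x y" "ip (r *\<^sub>R x) y = r *\<^sub>R ip x y"
    by (simp_all add: scaleR_cscale scl left)
qed

text \<open>Polarization: \<open>\<phi> (ip z z)\<close> is real for \<open>z = x + y\<close> and
  for \<open>z = x + \<i> y\<close>.\<close>

lemma state_ip_cnj:
  assumes hm: "hilbert_module act ip" and st: "is_state \<phi>"
  shows "\<phi> (ip y x) = cnj (\<phi> (ip x y))"
proof -
  have add: "\<phi> (x + y) = \<phi> x + \<phi> y" and scl: "\<phi> (cscale a x) = a * \<phi> x" for x y a
    using st by (auto simp: is_state_def)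
  have re: "Im (\<phi> (ip z z)) = 0" for z
    using st ip_positive[OF hm] by (auto simp: is_state_def)
  note ip = ip_add_left[OF hm] ip_add_right[OF hm] ip_cscale_left[OF hm] ip_cscale_right[OF hm]
  have "Im (\<phi> (ip x y)) + Im (\<phi> (ip y x)) = 0"
    using re[of "x + y"] re[of x] re[of y] by (simp add: ip add)
  moreover have "Re (\<phi> (ip x y)) = Re (\<phi> (ip y x))"
    using re[of "x + cscale \<i> y"] re[of x] re[of y] by (simp add: ip add scl cscale_cscale cscale_one)
  ultimately show ?thesis by (simp add: complex_eq_iff)
qed

text \<open>Zorn's lemma yields a maximal orthonormal subset of \<open>F\<close>; a further
  orthogonal unit vector would enlarge it. Existence keeps the supremum in \<open>M_eF\<close> from
  ranging over the empty set.\<close>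

lemma onb_quot_exists:
  assumes hm: "hilbert_module act ip" and st: "is_state \<phi>"
  shows "\<exists>B. onb_quot \<phi> ip F B"
proof -
  define S where "S = {B. B \<subseteq> F \<and> (\<forall>b\<in>B. \<forall>b'\<in>B. \<phi> (ip b b') = (if b = b' then 1 else 0))}"
  have "\<exists>M\<in>S. \<forall>X\<in>S. M \<subseteq> X \<longrightarrow> X = M"
  proof (rule subset_Zorn')
    fix C assume C: "subset.chain S C"
    have CS: "C \<subseteq> S" using C by (simp add: subset_chain_def)
    have "\<phi> (ip b b') = (if b = b' then 1 else 0)" if b: "b \<in> \<Union>C" "b' \<in> \<Union>C" for b b'
    proof -
      obtain B where "B \<in> C" "b \<in> B" "b' \<in> B"
        using b C unfolding subset_chain_def by blast
      then show ?thesis using CS unfolding S_def by blast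
    qed
    moreover have "\<Union>C \<subseteq> F" using CS unfolding S_def by blast
    ultimately show "\<Union>C \<in> S" unfolding S_def by blast
  qed
  then obtain B where B: "B \<in> S" and max: "\<And>X. X \<in> S \<Longrightarrow> B \<subseteq> X \<Longrightarrow> X = B" by blast
  have False if x: "x \<in> F" "\<phi> (ip x x) = 1" "\<forall>b\<in>B. \<phi> (ip b x) = 0" for x
  proof -
    have "x \<notin> B" using x by auto
    have "\<phi> (ip x b) = 0" if "b \<in> B" for b
      using x that state_ip_cnj[OF hm st, of x b] by simp
    then have "insert x B \<in> S" using B x \<open>x \<notin> B\<close> by (auto simp: S_def)
    then show False using max[of "insert x B"] \<open>x \<notin> B\<close> by blast
  qed
  then show ?thesis using B unfolding onb_quot_def S_def by blast
qed

text \<open>The element \<open>\<langle>x + tf | x + tf\<rangle>\<close> is, up to \<open>t\<^sup>2 \<langle>f|f\<rangle>\<close>, a convex combination of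
  \<open>\<langle>x|x\<rangle>\<close>, \<open>\<langle>x|x\<rangle> + \<langle>x|f\<rangle>\<close> and the adjoint of the latter; let \<open>t\<close> tend to 0.\<close>

lemma best_approx_upper_fun:
  assumes hm: "hilbert_module act ip"
    and best: "\<And>t::real. norm (ip x x) \<le> norm (ip (x + t *\<^sub>R f) (x + t *\<^sub>R f))"
  shows "norm (ip x x) \<le> upper_fun (ip x x + ip x f)"
proof (rule field_le_epsilon)
  fix \<epsilon> :: real assume \<epsilon>: "\<epsilon> > 0"
  define N where "N = norm (ip x x)"
  define m where "m = norm (ip f f)"
  define U where "U = upper_fun (ip x x + ip x f)"
  \<comment> \<open>The bound 1/2 keeps the coefficient \<open>1 - 2 * t\<close> nonnegative; the
    other one makes the quadratic remainder, once divided by \<open>t\<close>, at most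
    \<open>\<epsilon>\<close>.\<close>
  define t where "t = min (1/2) (\<epsilon> / (m + 1))"
  have m: "m \<ge> 0" by (simp add: m_def)
  have t: "0 < t" "t \<le> 1 / 2" "t * m \<le> \<epsilon>"
  proof -
    show "0 < t" using \<epsilon> m by (simp add: t_def)
    show "t \<le> 1 / 2" unfolding t_def by (rule min.cobounded1)
    have "t * m \<le> \<epsilon> / (m + 1) * m" using m by (intro mult_right_mono) (auto simp: t_def)
    also have "\<dots> \<le> \<epsilon>" using m \<epsilon> by (simp add: field_simps)
    finally show "t * m \<le> \<epsilon>" .
  qed
  note sub = sublinear_upper_fun
  have "ip (x + t *\<^sub>R f) (x + t *\<^sub>R f) =
      (1 - 2 * t) *\<^sub>R ip x x + (t *\<^sub>R (ip x x + ip x f) + (t *\<^sub>R (ip x x + ip f x) + (t * t) *\<^sub>R ip f f))"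
    by (simp add: ip_add_left[OF hm] ip_add_right[OF hm] ip_scaleR_left[OF hm] ip_scaleR_right[OF hm]
        algebra_simps flip: scaleR_2)
  then have "upper_fun (ip (x + t *\<^sub>R f) (x + t *\<^sub>R f)) \<le>
      upper_fun ((1 - 2 * t) *\<^sub>R ip x x) + (upper_fun (t *\<^sub>R (ip x x + ip x f)) +
        (upper_fun (t *\<^sub>R (ip x x + ip f x)) + upper_fun ((t * t) *\<^sub>R ip f f)))"
    by (auto intro!: order_trans[OF sublinear_add[OF sub]] add_left_mono)
  also have "\<dots> = (1 - 2 * t) * upper_fun (ip x x) + (t * U + (t * upper_fun (ip x x + ip f x)
      + t * t * upper_fun (ip f f)))"
    using t by (simp add: sublinear_scaleR[OF sub] U_def)
  also have "upper_fun (ip x x + ip f x) = U"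
    using upper_fun_adj[of "ip x x + ip x f"] by (simp add: U_def adj_add ip_adj[OF hm])
  finally have "norm (ip (x + t *\<^sub>R f) (x + t *\<^sub>R f)) \<le> (1 - 2 * t) * N + (t * U + (t * U + t * t * m))"
    by (simp add: upper_fun_positive[OF ip_positive[OF hm]] N_def m_def)
  then have "N \<le> (1 - 2 * t) * N + (t * U + (t * U + t * t * m))"
    using best[of t] by (simp add: N_def)
  then have "t * (2 * N) \<le> t * (2 * U + t * m)" by (simp add: algebra_simps)
  then have "2 * N \<le> 2 * U + t * m" using t(1) by simp
  then show "norm (ip x x) \<le> upper_fun (ip x x + ip x f) + \<epsilon>"
    using t \<epsilon> by (simp add: N_def U_def)
qed

text \<open>Mazur-Orlicz is applied to the convex set of all \<open>ip x x + ip x f\<close>. The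
  domination \<open>g \<le> upper_fun\<close> both makes \<open>g\<close> the real part of a state
  and caps \<open>g (ip x x)\<close> at the norm.\<close>

lemma best_approx_state_exists:
  assumes hm: "hilbert_module act ip" and F: "csubspace F"
    and best: "\<And>f. f \<in> F \<Longrightarrow> norm (ip x x) \<le> norm (ip (x + f) (x + f))"
  shows "\<exists>\<phi>. is_state \<phi> \<and> \<phi> (ip x x) = of_real (norm (ip x x)) \<and> (\<forall>f\<in>F. \<phi> (ip x f) = 0)"
proof -
  define N where "N = norm (ip x x)"
  define K where "K = (\<lambda>f. ip x x + ip x f) ` F"
  have F0: "0 \<in> F" and Fadd: "\<And>f h. f \<in> F \<Longrightarrow> h \<in> F \<Longrightarrow> f + h \<in> F"
    and Fc: "\<And>c f. f \<in> F \<Longrightarrow> cscale c f \<in> F" and Fr: "\<And>r f. f \<in> F \<Longrightarrow> r *\<^sub>R f \<in> F"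
    using F by (auto simp: csubspace_def scaleR_cscale)
  have "N \<le> upper_fun w" if "w \<in> K" for w
    using that best Fr unfolding K_def N_def
    by (auto intro!: best_approx_upper_fun[OF hm])
  moreover have "convex K"
  proof (rule convexI)
    fix a b and u v :: real assume ab: "a \<in> K" "b \<in> K" and uv: "0 \<le> u" "0 \<le> v" "u + v = 1"
    obtain f h where fh: "f \<in> F" "h \<in> F" "a = ip x x + ip x f" "b = ip x x + ip x h"
      using ab by (auto simp: K_def)
    have "u *\<^sub>R a + v *\<^sub>R b = (u + v) *\<^sub>R ip x x + ip x (u *\<^sub>R f + v *\<^sub>R h)"
      by (simp add: fh ip_add_right[OF hm] ip_scaleR_right[OF hm] algebra_simps)
    then have "u *\<^sub>R a + v *\<^sub>R b = ip x x + ip x (u *\<^sub>R f + v *\<^sub>R h)" using uv by simp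
    then show "u *\<^sub>R a + v *\<^sub>R b \<in> K" using fh Fadd Fr by (auto simp: K_def)
  qed
  moreover have "K \<noteq> {}" using F0 by (auto simp: K_def)
  ultimately obtain g where lin: "linear g" and gle: "\<And>y. g y \<le> upper_fun y" and gK: "\<And>w. w \<in> K \<Longrightarrow> N \<le> g w"
    using mazur_orlicz[OF sublinear_upper_fun, of K N] by blast
  have low: "N \<le> g (ip x x) + g (ip x f)" if "f \<in> F" for f
    using gK[of "ip x x + ip x f"] that by (simp add: K_def linear_add[OF lin])
  have gN: "g (ip x x) = N"
  proof (rule antisym)
    show "g (ip x x) \<le> N" using gle upper_fun_le_norm unfolding N_def by (rule order_trans)
    show "N \<le> g (ip x x)"
      using low[OF F0] ip_scaleR_right[OF hm, of x 0 0] by (simp add: linear_0[OF lin])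
  qed
  \<comment> \<open>Comparing \<open>f\<close> with \<open>- f\<close> bounds
    \<open>g (ip x f)\<close> from both sides by 0.\<close>
  have g0: "g (ip x f) = 0" if "f \<in> F" for f
    using low[OF that] low[OF Fr[OF that, of "- 1"]] gN
    by (simp only: ip_scaleR_right[OF hm] linear_scale[OF lin]) simp
  define \<phi> where "\<phi> = (\<lambda>y. Complex (g y) (- g (cscale \<i> y)))"
  have st: "is_state \<phi>" unfolding \<phi>_def using lin gle by (rule state_of_dominated_functional)
  then have "Im (\<phi> (ip x x)) = 0" using ip_positive[OF hm] by (auto simp: is_state_def)
  then have "\<phi> (ip x x) = of_real N" using gN by (simp add: complex_eq_iff \<phi>_def)
  \<comment> \<open>The imaginary part vanishes because \<open>\<i> f\<close> also lies in
    \<open>F\<close>.\<close>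
  moreover have "\<phi> (ip x f) = 0" if "f \<in> F" for f
    using g0[OF that] g0[OF Fc[OF that, of \<i>]]
    by (simp add: \<phi>_def ip_cscale_right[OF hm] complex_eq_iff)
  ultimately show ?thesis using st N_def by blast
qed

theorem theorem4p6:
  fixes act :: "'m::cvector \<Rightarrow> 'a::cstar_algebra \<Rightarrow> 'm"
    and ip :: "'m \<Rightarrow> 'm \<Rightarrow> 'a"
    and e f0 :: 'm and F :: "'m set"
  assumes "hilbert_module act ip"
    and "csubspace F"
    and "f0 \<in> F"
    and "\<forall>f\<in>F. hnorm ip (e - f0) \<le> hnorm ip (e - f)"
  shows "(\<exists>\<phi>. is_state \<phi> \<and> M_eF ip e F f0 \<phi> = (hdist_set ip e F)\<^sup>2) \<and>
         (\<forall>\<phi>. is_state \<phi> \<longrightarrow> M_eF ip e F f0 \<phi> \<le> (hdist_set ip e F)\<^sup>2)"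
proof -
  note hm = assms(1)
  define x where "x = e - f0"
  define N where "N = norm (ip x x)"
  have "hdist_set ip e F = hnorm ip (e - f0)"
    unfolding hdist_set_def using assms by (intro cInf_eq_minimum) auto
  then have dist: "(hdist_set ip e F)\<^sup>2 = N"
    by (simp add: hnorm_def N_def x_def)
  \<comment> \<open>The competitor is \<open>f0 - f\<close>, for which
    \<open>e - (f0 - f) = x + f\<close>.\<close>
  have best: "norm (ip x x) \<le> norm (ip (x + f) (x + f))" if "f \<in> F" for f
  proof -
    have "f0 + cscale (- 1) f \<in> F" using assms that by (auto simp: csubspace_def)
    then have "f0 - f \<in> F" by (simp add: cscale_minus_left cscale_one)
    then have "hnorm ip x \<le> hnorm ip (e - (f0 - f))" using assms by (simp add: x_def)
    then show ?thesis by (simp add: hnorm_def x_def algebra_simps)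
  qed
  obtain \<phi> where st: "is_state \<phi>" and \<phi>N: "\<phi> (ip x x) = of_real N" and \<phi>0: "\<And>f. f \<in> F \<Longrightarrow> \<phi> (ip x f) = 0"
    using best_approx_state_exists[OF hm assms(2) best] N_def by blast
  have "(\<Sum>\<^sub>\<infinity>b\<in>B. (cmod (\<phi> (ip x b)))\<^sup>2) = 0" if "onb_quot \<phi> ip F B" for B
    using that \<phi>0 by (intro infsum_0) (auto simp: onb_quot_def)
  \<comment> \<open>Every basis gives the value \<open>N\<close> and at least one basis exists, so
    the set is a singleton.\<close>
  then have "{Re (\<phi> (ip x x)) - (\<Sum>\<^sub>\<infinity>b\<in>B. (cmod (\<phi> (ip x b)))\<^sup>2) | B. onb_quot \<phi> ip F B} = {N}"
    using onb_quot_exists[OF hm st, of F] \<phi>N by force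
  then have "M_eF ip e F f0 \<phi> = N"
    unfolding M_eF_def x_def[symmetric] by simp
  moreover have "M_eF ip e F f0 \<psi> \<le> N" if \<psi>: "is_state \<psi>" for \<psi>
    unfolding M_eF_def x_def[symmetric]
  proof (rule cSup_least)
    show "{Re (\<psi> (ip x x)) - (\<Sum>\<^sub>\<infinity>b\<in>B. (cmod (\<psi> (ip x b)))\<^sup>2) | B. onb_quot \<psi> ip F B} \<noteq> {}"
      using onb_quot_exists[OF hm \<psi>, of F] by blast
  next
    fix s assume "s \<in> {Re (\<psi> (ip x x)) - (\<Sum>\<^sub>\<infinity>b\<in>B. (cmod (\<psi> (ip x b)))\<^sup>2) | B. onb_quot \<psi> ip F B}"
    then obtain B where "s = Re (\<psi> (ip x x)) - (\<Sum>\<^sub>\<infinity>b\<in>B. (cmod (\<psi> (ip x b)))\<^sup>2)" by blast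
    \<comment> \<open>A non-summable family has \<open>infsum\<close> equal to 0, so the bound holds
      in that case as well.\<close>
    moreover have "(\<Sum>\<^sub>\<infinity>b\<in>B. (cmod (\<psi> (ip x b)))\<^sup>2) \<ge> 0" by (intro infsum_nonneg) simp
    moreover have "Re (\<psi> (ip x x)) \<le> N"
      unfolding N_def using \<psi> ip_positive[OF hm] by (rule state_positive_le_norm)
    ultimately show "s \<le> N" by linarith
  qed
  ultimately show ?thesis using st dist by auto
qed

end
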